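(* Let $f\in\mathscr{S}(\mathbb{R}^n\times\mathbb{R})$, $b,\eta\in\mathbb{R}$, and $x\in\mathbb{R}^n$. Then $$\sin(b\eta)\,f^{I,F}(x,\eta)=\frac1i\big[f^e_b-\tau_{(0,-b)}f^e_0\big]^{I,F}(x,\eta).$$
   Context: $\mathscr{S}$ is the Schwartz space; points of $\mathbb{R}^n\times\mathbb{R}$ are $(x,y)$. $f^{I,F}(x,\eta)=\frac{1}{\sqrt{2\pi}}\int_{\mathbb{R}}e^{-iy\eta}f(x,y)\,dy$ is the Fourier transform in the last variable only. $(\tau_{(a,b)}f)(x,y)=f(x+a,y+b)$ for $a\in\mathbb{R}^n,b\in\mathbb{R}$. For $b\in\mathbb{R}$, $f^e_b(x,y)=\frac12[f(x,y+b)+f(x,-y+b)]$. *)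

theory Defs
  imports "HOL-Analysis.Analysis"
begin

definition partial_deriv :: "'a::euclidean_space \<Rightarrow> ('a \<Rightarrow> 'b::real_normed_vector) \<Rightarrow> 'a \<Rightarrow> 'b"
  where "partial_deriv i f z = vector_derivative (\<lambda>t. f (z + t *\<^sub>R i)) (at 0)"

text \<open>Derivatives of order \<open>k\<close> are indexed by lists of \<open>k\<close> basis vectors rather than by
  multi-indices, so every order of differentiation is included. On smooth functions the order
  is irrelevant, and these are exactly the derivatives given by multi-indices.\<close>

definition iterated_partial ::
    "'a::euclidean_space list \<Rightarrow> ('a \<Rightarrow> 'b::real_normed_vector) \<Rightarrow> 'a \<Rightarrow> 'b"
  where "iterated_partial is f = foldr partial_deriv is f"

text \<open>The class of infinitely differentiable functions: all partial derivatives of all orders exist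
  everywhere and are continuous. The existence clause is needed because \<open>vector_derivative\<close>
  is total.\<close>

definition C_infinity :: "('a::euclidean_space \<Rightarrow> 'b::real_normed_vector) set"
  where "C_infinity = {f. \<forall>is \<in> lists Basis.
    continuous_on UNIV (iterated_partial is f) \<and>
    (\<forall>i\<in>Basis. \<forall>z. (\<lambda>t. iterated_partial is f (z + t *\<^sub>R i)) differentiable (at (0::real)))}"

definition monomial :: "('a::euclidean_space \<Rightarrow> nat) \<Rightarrow> 'a \<Rightarrow> real"
  where "monomial \<alpha> z = (\<Prod>i\<in>Basis. (z \<bullet> i) ^ \<alpha> i)"

definition schwartz_space :: "('a::euclidean_space \<Rightarrow> complex) set"
  where "schwartz_space = {f \<in> C_infinity. \<forall>\<alpha>. \<forall>is \<in> lists Basis.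
    bounded (range (\<lambda>z. monomial \<alpha> z *\<^sub>R iterated_partial is f z))}"

definition fourier_last :: "('a \<times> real \<Rightarrow> complex) \<Rightarrow> 'a \<times> real \<Rightarrow> complex"
  where "fourier_last f = (\<lambda>(x, \<eta>). complex_of_real (1 / sqrt (2 * pi)) *
    (LINT y|lborel. exp (- (\<i> * complex_of_real y * complex_of_real \<eta>)) * f (x, y)))"

definition translate ::
    "'a::ab_group_add \<times> real \<Rightarrow> ('a \<times> real \<Rightarrow> complex) \<Rightarrow> 'a \<times> real \<Rightarrow> complex"
  where "translate = (\<lambda>(a, b) f (x, y). f (x + a, y + b))"

text \<open>The part of \<open>f\<close> that is even in its last variable about the hyperplane \<open>y = b\<close>,
  recentred to \<open>y = 0\<close>.\<close>

definition even_part :: "real \<Rightarrow> ('a \<times> real \<Rightarrow> complex) \<Rightarrow> 'a \<times> real \<Rightarrow> complex"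
  where "even_part b f = (\<lambda>(x, y). (1 / 2) * (f (x, y + b) + f (x, - y + b)))"

end

theory Submission
  imports Defs "HOL-Probability.Sinc_Integral"
begin

text \<open>
  Writing out the two even parts at \<open>(x, y)\<close>, the reflected terms \<open>f (x, - y + b)\<close> are common to
  both and cancel. What remains is \<open>(f (x, y + b) - f (x, y - b)) / 2\<close>, half the difference of two
  translates of \<open>f\<close> in the last variable. Under the Fourier transform in that variable a translation
  by \<open>\<plusminus>b\<close> becomes multiplication by \<open>exp (\<plusminus>\<i> b \<eta>)\<close> (\<open>fourier_last_translate\<close>), and
  \<open>(exp (\<i> b \<eta>) - exp (- \<i> b \<eta>)) / 2 = \<i> sin (b \<eta>)\<close>.

  The decay of \<open>f\<close> enters only when the integral of the difference is split, which requires every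
  slice \<open>y \<mapsto> f (x, y)\<close> to be integrable (\<open>schwartz_slice_integrable\<close>).
\<close>

lemma schwartz_continuous:
  assumes "f \<in> schwartz_space"
  shows "continuous_on UNIV f"
proof -
  have "continuous_on UNIV (iterated_partial [] f)"
    using assms unfolding schwartz_space_def C_infinity_def by blast
  then show ?thesis
    by (simp add: iterated_partial_def)
qed

lemma schwartz_monomial_bound:
  assumes "f \<in> schwartz_space"
  obtains M where "\<And>z. \<bar>monomial \<alpha> z\<bar> * norm (f z) \<le> M"
proof -
  have "bounded (range (\<lambda>z. monomial \<alpha> z *\<^sub>R iterated_partial [] f z))"
    using assms unfolding schwartz_space_def by blast
  then show ?thesis
    using that by (auto simp: bounded_iff iterated_partial_def)
qed

lemma monomial_zero: "monomial (\<lambda>_. 0) z = 1"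
  by (simp add: monomial_def)

lemma monomial_single:
  assumes "i \<in> Basis"
  shows "monomial (\<lambda>j. if j = i then k else 0) z = (z \<bullet> i) ^ k"
proof -
  have "monomial (\<lambda>j. if j = i then k else 0) z = (\<Prod>j\<in>Basis. if j = i then (z \<bullet> i) ^ k else 1)"
    unfolding monomial_def by (rule prod.cong) auto
  then show ?thesis
    using assms by simp
qed

text \<open>Decay of order two in the last variable alone is already enough: the constant monomial and the
  square of the last coordinate together dominate a slice by a multiple of \<open>1 / (1 + y\<^sup>2)\<close>.\<close>

lemma schwartz_slice_integrable:
  fixes f :: "'a::euclidean_space \<times> real \<Rightarrow> complex"
  assumes f: "f \<in> schwartz_space"
  shows "integrable lborel (\<lambda>y. f (x, y))"
proof -
  obtain M0 where M0: "\<And>z. norm (f z) \<le> M0"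
    using schwartz_monomial_bound[OF f, of "\<lambda>_. 0"] by (auto simp: monomial_zero)
  have last: "(0, 1) \<in> (Basis :: ('a \<times> real) set)"
    by (simp add: Basis_prod_def)
  obtain M2 where M2: "\<And>z. (z \<bullet> (0, 1))\<^sup>2 * norm (f z) \<le> M2"
    using schwartz_monomial_bound[OF f, of "\<lambda>j. if j = (0, 1) then 2 else 0"]
    by (auto simp: monomial_single[OF last])
  have bound: "norm (f (x, y)) \<le> (M0 + M2) * inverse (1 + y\<^sup>2)" for y
  proof -
    have "(1 + y\<^sup>2) * norm (f (x, y)) \<le> M0 + M2"
      using M0[of "(x, y)"] M2[of "(x, y)"] by (simp add: distrib_right)
    moreover have "0 < 1 + y\<^sup>2"
      by (simp add: add_pos_nonneg)
    ultimately show ?thesis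
      by (simp add: field_simps)
  qed
  have "continuous_on UNIV (\<lambda>y. f (x, y))"
    by (rule continuous_on_compose2[OF schwartz_continuous[OF f]]) (auto intro!: continuous_intros)
  then have meas: "(\<lambda>y. f (x, y)) \<in> borel_measurable lborel"
    using borel_measurable_continuous_onI by auto
  have "integrable lborel (\<lambda>y::real. inverse (1 + y\<^sup>2))"
    using integrable_inverse_1_plus_square by (simp add: set_integrable_def)
  then have "integrable lborel (\<lambda>y. (M0 + M2) * inverse (1 + y\<^sup>2))"
    by simp
  moreover have "AE y in lborel. norm (f (x, y)) \<le> norm ((M0 + M2) * inverse (1 + y\<^sup>2))"
    using order_trans[OF bound abs_ge_self] by simp
  ultimately show ?thesis
    using meas by (blast intro: Bochner_Integration.integrable_bound)
qed

lemma integrable_fourier_kernel: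
  fixes g :: "real \<Rightarrow> complex"
  assumes "integrable lborel g"
  shows "integrable lborel (\<lambda>y. exp (- (\<i> * complex_of_real y * complex_of_real \<eta>)) * g y)"
  by (rule Bochner_Integration.integrable_bound[OF assms])
    (use assms in \<open>auto simp: norm_mult\<close>)

lemma fourier_last_diff:
  assumes "integrable lborel (\<lambda>y. g (x, y))" and "integrable lborel (\<lambda>y. h (x, y))"
  shows "fourier_last (\<lambda>z. g z - h z) (x, \<eta>) = fourier_last g (x, \<eta>) - fourier_last h (x, \<eta>)"
  using assms[THEN integrable_fourier_kernel]
  by (simp add: fourier_last_def right_diff_distrib diff_divide_distrib)

lemma fourier_last_cmult:
  "fourier_last (\<lambda>z. c * g z) (x, \<eta>) = c * fourier_last g (x, \<eta>)"
  by (simp add: fourier_last_def mult.left_commute)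

text \<open>The substitution \<open>y \<mapsto> y - b\<close> moves the translation onto the kernel, where it is a constant
  phase.\<close>

lemma fourier_last_translate:
  "fourier_last (translate (0, b) f) (x, \<eta>) =
    exp (\<i> * complex_of_real (b * \<eta>)) * fourier_last f (x, \<eta>)"
proof -
  let ?E = "\<lambda>y. exp (- (\<i> * complex_of_real y * complex_of_real \<eta>))"
  have phase: "?E (y - b) = exp (\<i> * complex_of_real (b * \<eta>)) * ?E y" for y
    unfolding exp_add[symmetric] by (rule arg_cong[of _ _ exp]) (simp add: algebra_simps)
  have "(LINT y|lborel. ?E y * f (x, y + b)) = (LINT y|lborel. ?E (y - b) * f (x, y))"
    using lborel_integral_real_affine[of 1 "\<lambda>y. ?E (y - b) * f (x, y)" b]
    by (simp add: add.commute)
  also have "\<dots> = (LINT y|lborel. exp (\<i> * complex_of_real (b * \<eta>)) * (?E y * f (x, y)))"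
    by (simp only: phase flip: mult.assoc)
  finally show ?thesis
    by (simp add: fourier_last_def translate_def mult.left_commute)
qed

lemma translate_slice_integrable:
  assumes "integrable lborel (\<lambda>y. f (x, y))"
  shows "integrable lborel (\<lambda>y. translate (0, b) f (x, y))"
  using lborel_integrable_real_affine[OF assms, of 1 b]
  by (simp add: translate_def add.commute)

text \<open>The shift by \<open>- b\<close> turns \<open>f (x, - y)\<close> into \<open>f (x, - (y - b))\<close>, which is exactly the
  reflected term of the even part about \<open>y = b\<close>, so the two cancel.\<close>

lemma even_part_diff_translate:
  "even_part b f z - translate (0, - b) (even_part 0 f) z =
    1 / 2 * (translate (0, b) f z - translate (0, - b) f z)"
  by (cases z) (simp add: even_part_def translate_def algebra_simps)

theorem theorem5p1p3:
  fixes f :: "(real ^ 'n) \<times> real \<Rightarrow> complex"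
    and b \<eta> :: real
    and x :: "real ^ 'n"
  assumes "f \<in> schwartz_space"
  shows "complex_of_real (sin (b * \<eta>)) * fourier_last f (x, \<eta>) =
    (1 / \<i>) * fourier_last (\<lambda>z. even_part b f z - translate (0, - b) (even_part 0 f) z) (x, \<eta>)"
proof -
  let ?t = "complex_of_real (b * \<eta>)"
  note slice = translate_slice_integrable[OF schwartz_slice_integrable[OF assms]]
  have "fourier_last (\<lambda>z. even_part b f z - translate (0, - b) (even_part 0 f) z) (x, \<eta>) =
      1 / 2 * (fourier_last (translate (0, b) f) (x, \<eta>) -
        fourier_last (translate (0, - b) f) (x, \<eta>))"
    by (simp only: even_part_diff_translate fourier_last_cmult fourier_last_diff[OF slice slice])
  also have "\<dots> = (exp (\<i> * ?t) - exp (- (\<i> * ?t))) / 2 * fourier_last f (x, \<eta>)"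
    by (simp add: fourier_last_translate algebra_simps)
  also have "(exp (\<i> * ?t) - exp (- (\<i> * ?t))) / 2 = \<i> * sin ?t"
    by (simp add: sin_exp_eq diff_divide_distrib)
  finally show ?thesis
    by (simp add: mult.assoc flip: sin_of_real)
qed

end
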